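(* Assume $\mathfrak b=\mathfrak c$ and that there is a tight $\omega^\omega$-gap. Then there are two countable Fréchet spaces whose product is not M-separable.
   Context: All topological spaces are assumed to be regular and Hausdorff. A space is Fréchet (Fréchet–Urysohn) if whenever a point $x$ is in the closure of a set $A$, there is an $\omega$-sequence of points of $A$ converging to $x$. A space $X$ is M-separable (selectively separable) if for every countable family $\{D_n:n\in\omega\}$ of dense subsets of $X$ there are finite sets $H_n\subset D_n$ ($n\in\omega$) such that $\bigcup_n H_n$ is dense in $X$. $\mathfrak b$ is the bounding number (the least cardinality of a $\leq^*$-unbounded subset of $\omega^\omega$, where $\leq^*$ is the mod finite order) and $\mathfrak c=2^{\aleph_0}$. For $f\in\omega^\omega$ let $f^{\downarrow}=\{(n,m)\in\omega\times\omega: m<f(n)\}$. Two families of subsets of a countable set are orthogonal if each member of the first has finite intersection with each member of the second. Two ideals $\mathcal I_1,\mathcal I_2$ form a tight $\omega^\omega$-gap if: (1) every member of $\mathcal I_1\cup\mathcal I_2$ is a subset of $\omega\times\omega$; (2) each $I\in\mathcal I_1\cup\mathcal I_2$ is a subset of $f^{\downarrow}$ for some $f\in\omega^\omega$; (3) $\mathcal I_1$ and $\mathcal I_2$ are orthogonal; (4) for each $f\in\omega^\omega$ there are $a_f\in\mathcal I_1$ and $b_f\in\mathcal I_2$ such that $f^{\downarrow}=a_f\cup b_f$; (5) for any $X\subset\omega\times\omega$ such that $\{n\in\omega: X\cap(\{n\}\times\omega)\text{ is infinite}\}$ is infinite, there is an $f\in\omega^\omega$ such that both $X\cap a_f$ and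 $X\cap b_f$ are infinite. *)

theory Defs
  imports "HOL-Analysis.Analysis"
begin

unbundle cardinal_syntax

definition frechet_urysohn_space :: "'a topology \<Rightarrow> bool" where
  "frechet_urysohn_space X \<longleftrightarrow>
     (\<forall>A x. A \<subseteq> topspace X \<and> x \<in> X closure_of A \<longrightarrow>
        (\<exists>s :: nat \<Rightarrow> 'a. range s \<subseteq> A \<and> limitin X s x sequentially))"

definition dense_subset_of :: "'a topology \<Rightarrow> 'a set \<Rightarrow> bool" where
  "dense_subset_of X D \<longleftrightarrow> D \<subseteq> topspace X \<and> X closure_of D = topspace X"

definition M_separable_space :: "'a topology \<Rightarrow> bool" where
  "M_separable_space X \<longleftrightarrow>
     (\<forall>D :: nat \<Rightarrow> 'a set. (\<forall>n. dense_subset_of X (D n)) \<longrightarrow>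
        (\<exists>H. (\<forall>n. finite (H n) \<and> H n \<subseteq> D n) \<and> dense_subset_of X (\<Union>n. H n)))"

definition le_star :: "(nat \<Rightarrow> nat) \<Rightarrow> (nat \<Rightarrow> nat) \<Rightarrow> bool" where
  "le_star f g \<longleftrightarrow> finite {n. \<not> f n \<le> g n}"

definition unbounded_family :: "(nat \<Rightarrow> nat) set \<Rightarrow> bool" where
  "unbounded_family B \<longleftrightarrow> \<not> (\<exists>g. \<forall>f\<in>B. le_star f g)"

text \<open>Cardinals are the library's cardinal orders, determined up to \<open>=o\<close>.
  The choice below is well defined by \<open>bounding_number_least\<close>.\<close>

definition bounding_number :: "(nat \<Rightarrow> nat) rel" where
  "bounding_number =
     (SOME r. (\<exists>B. unbounded_family B \<and> r = |B| ) \<and>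
        (\<forall>B. unbounded_family B \<longrightarrow> r \<le>o |B| ))"

definition continuum :: "(nat \<Rightarrow> bool) rel" where
  "continuum = ctwo ^c natLeq"

lemma unbounded_family_UNIV: "unbounded_family UNIV"
proof -
  have "\<not> le_star (\<lambda>n. Suc (g n)) g" for g
    by (simp add: le_star_def)
  then show ?thesis
    unfolding unbounded_family_def by blast
qed

lemma bounding_number_least:
  shows "\<exists>B. unbounded_family B \<and> bounding_number = |B|"
    and "unbounded_family B \<Longrightarrow> bounding_number \<le>o |B|"
proof -
  let ?R = "{ |B| | B. unbounded_family B}"
  have "?R \<noteq> {}" using unbounded_family_UNIV by blast
  moreover have "\<forall>r\<in>?R. Card_order r" using card_of_Card_order by blast
  ultimately have "\<exists>r\<in>?R. \<forall>r'\<in>?R. r \<le>o r'" by (rule exists_minim_Card_order)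
  then have "\<exists>r. (\<exists>B. unbounded_family B \<and> r = |B| ) \<and> (\<forall>B. unbounded_family B \<longrightarrow> r \<le>o |B| )"
    by blast
  from someI_ex[OF this]
  show "\<exists>B. unbounded_family B \<and> bounding_number = |B|"
    and "unbounded_family B \<Longrightarrow> bounding_number \<le>o |B|"
    unfolding bounding_number_def by blast+
qed

definition down_graph :: "(nat \<Rightarrow> nat) \<Rightarrow> (nat \<times> nat) set" where
  "down_graph f = {(n, m). m < f n}"

definition orthogonal_families :: "'a set set \<Rightarrow> 'a set set \<Rightarrow> bool" where
  "orthogonal_families \<A> \<B> \<longleftrightarrow> (\<forall>A\<in>\<A>. \<forall>B\<in>\<B>. finite (A \<inter> B))"

text \<open>Ideals are not required to contain the finite sets. For the gaps below this is
  immaterial: adding finite sets to the members of both ideals preserves every clause.\<close>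

definition set_ideal :: "'a set set \<Rightarrow> bool" where
  "set_ideal \<I> \<longleftrightarrow> {} \<in> \<I> \<and> (\<forall>A\<in>\<I>. \<forall>B. B \<subseteq> A \<longrightarrow> B \<in> \<I>) \<and> (\<forall>A\<in>\<I>. \<forall>B\<in>\<I>. A \<union> B \<in> \<I>)"

text \<open>That the members are subsets of \<open>\<omega> \<times> \<omega>\<close> is expressed by the type. The sets
  \<open>a f\<close> and \<open>b f\<close> are determined by \<open>f\<close> up to finite sets because of
  orthogonality, so the last clause does not depend on their choice.\<close>

definition tight_gap :: "(nat \<times> nat) set set \<Rightarrow> (nat \<times> nat) set set \<Rightarrow> bool" where
  "tight_gap \<I>\<^sub>1 \<I>\<^sub>2 \<longleftrightarrow>
     set_ideal \<I>\<^sub>1 \<and> set_ideal \<I>\<^sub>2 \<and>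
     (\<forall>I\<in>\<I>\<^sub>1 \<union> \<I>\<^sub>2. \<exists>f. I \<subseteq> down_graph f) \<and>
     orthogonal_families \<I>\<^sub>1 \<I>\<^sub>2 \<and>
     (\<exists>a b. (\<forall>f. a f \<in> \<I>\<^sub>1 \<and> b f \<in> \<I>\<^sub>2 \<and> down_graph f = a f \<union> b f) \<and>
        (\<forall>X. infinite {n. infinite (X \<inter> ({n} \<times> UNIV))} \<longrightarrow>
           (\<exists>f. infinite (X \<inter> a f) \<and> infinite (X \<inter> b f))))"

end

theory Submission
  imports Defs
begin

text \<open>Code \<open>\<omega> \<times> \<omega>\<close> by \<open>\<omega>\<close>. One builds two topologies on \<open>\<omega>\<close> such that members of the first
  ideal are closed discrete in \<open>X\<close>, members of the second are closed discrete in \<open>Y\<close>, and for all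
  \<open>x\<close>, \<open>y\<close>, \<open>n\<close> the \<open>n\<close>-th column contains a sequence converging to \<open>x\<close> in \<open>X\<close> and to \<open>y\<close> in \<open>Y\<close>.
  Then the diagonals of the columns are dense in \<open>X \<times> Y\<close>, while any finite selection from them lies
  over some \<open>f\<^sup>\<down> = a\<^sub>f \<union> b\<^sub>f\<close>, and the diagonals of \<open>a\<^sub>f\<close> and \<open>b\<^sub>f\<close> are closed discrete in the product.

  Each topology arises from a recursion of length \<open>\<cc>\<close> on pairs \<open>(A, x)\<close>, which accumulates promised
  convergent sequences, each lying in the opposite ideal or in one column, and promised clopen sets. The
  set \<open>A\<^sup>*\<close> of points that are, as far as the clopen sets chosen so far can tell, limits of
  such sequences in \<open>A\<close> is sequentially closed: fewer than \<open>\<bb>\<close> clopen sets are controlled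
  by one dominating function, and tightness yields a sequence of the allowed kind inside the
  tails it selects. If \<open>x\<close> is in \<open>A\<^sup>*\<close>, a sequence is added; otherwise \<open>\<bb>\<close> is used once more to add a
  clopen set separating \<open>x\<close> from \<open>A\<^sup>*\<close> and respecting all promised sequences.\<close>

section \<open>Few sequences can be separated by clopen sets\<close>

text \<open>What a clopen \<open>U\<close> demands of \<open>T\<close> for convergence to
  \<open>x\<close>. Sequences are coded as sets, since their order is immaterial.\<close>

definition settles :: "'a set \<Rightarrow> 'a \<Rightarrow> 'a set \<Rightarrow> bool" where
  "settles T x U \<longleftrightarrow> finite {t \<in> T. (t \<in> U) \<noteq> (x \<in> U)}"

lemma settles_subset: "settles T x U \<Longrightarrow> S \<subseteq> T \<Longrightarrow> settles S x U"
  unfolding settles_def by (erule rev_finite_subset) blast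

lemma settles_UNIV [simp]: "settles T x UNIV"
  by (simp add: settles_def)

lemma settles_cases:
  "settles T x U \<longleftrightarrow> (if x \<in> U then finite (T - U) else finite (T \<inter> U))"
proof -
  have "{t \<in> T. (t \<in> U) \<noteq> (x \<in> U)} = (if x \<in> U then T - U else T \<inter> U)" by auto
  then show ?thesis by (simp add: settles_def)
qed

text \<open>Uniqueness of limits, with the \<open>V i\<close> as separating clopen sets.\<close>

lemma settles_both_imp_eq:
  assumes "\<And>x y. x \<noteq> y \<Longrightarrow> \<exists>i. (x \<in> V i) \<noteq> (y \<in> V i)"
    and "\<And>i. settles S x (V i)" and "\<And>i. settles R y (V i)" and "infinite (S \<inter> R)"
  shows "x = y"
proof (rule ccontr)
  assume "x \<noteq> y"
  then obtain i where i: "(x \<in> V i) \<noteq> (y \<in> V i)" using assms(1) by blast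
  have "S \<inter> R \<subseteq> {t \<in> S. (t \<in> V i) \<noteq> (x \<in> V i)} \<union> {t \<in> R. (t \<in> V i) \<noteq> (y \<in> V i)}"
    using i by blast
  then show False
    using assms(2)[of i] assms(3)[of i] assms(4) unfolding settles_def
    by (meson finite_UnI finite_subset)
qed

lemma bounded_if_less_bounding_number:
  assumes "|A| <o bounding_number"
  obtains g where "\<And>x. x \<in> A \<Longrightarrow> le_star (h x) g"
proof -
  have "|h ` A| <o bounding_number"
    using card_of_image assms by (rule ordLeq_ordLess_trans)
  then have "\<not> unbounded_family (h ` A)"
    using bounding_number_least(2) not_ordLess_ordLeq by blast
  then show thesis using that unfolding unbounded_family_def by blast
qed

text \<open>Each \<open>S\<close> lies almost inside every finite intersection \<open>B k\<close> of
  neighbourhoods of \<open>y\<close>. As there are few \<open>S\<close>, one \<open>g\<close>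
  eventually bounds all \<open>h S\<close>, and the diagonal set \<open>R\<close> absorbs every
  \<open>S\<close> modulo finite while still converging to \<open>y\<close>.\<close>

lemma convergent_hull:
  fixes V :: "nat \<Rightarrow> nat set"
  assumes small: "|C| <o bounding_number"
    and conv: "\<And>S i. S \<in> C \<Longrightarrow> settles S y (V i)"
  obtains R where "\<And>i. settles R y (V i)" and "\<And>S. S \<in> C \<Longrightarrow> finite (S - R)"
proof -
  define B where "B k = {p. \<forall>i<k. (p \<in> V i) = (y \<in> V i)}" for k
  have "finite (S - B k)" if "S \<in> C" for S k
  proof -
    have "S - B k \<subseteq> (\<Union>i<k. {t \<in> S. (t \<in> V i) \<noteq> (y \<in> V i)})" by (auto simp: B_def)
    moreover have "finite (\<Union>i<k. {t \<in> S. (t \<in> V i) \<noteq> (y \<in> V i)})"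
      using conv[OF that] by (auto simp: settles_def)
    ultimately show ?thesis by (rule finite_subset)
  qed
  then have "\<forall>S k. \<exists>m. S \<in> C \<longrightarrow> S - B k \<subseteq> {..<m}"
    by (metis finite_nat_iff_bounded)
  then obtain h where h: "\<And>S k. S \<in> C \<Longrightarrow> S - B k \<subseteq> {..<h S k}"
    by metis
  obtain g where g: "\<And>S. S \<in> C \<Longrightarrow> le_star (h S) g"
    using bounded_if_less_bounding_number[OF small] by blast
  define R where "R = {p. \<forall>k. g k \<le> p \<longrightarrow> p \<in> B k}"
  have "settles R y (V i)" for i
  proof -
    have "{t \<in> R. (t \<in> V i) \<noteq> (y \<in> V i)} \<subseteq> {..<g (Suc i)}"
    proof
      fix t assume t: "t \<in> {t \<in> R. (t \<in> V i) \<noteq> (y \<in> V i)}"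
      then have "t \<notin> B (Suc i)" by (auto simp: B_def)
      with t show "t \<in> {..<g (Suc i)}" unfolding R_def by (force simp: not_le)
    qed
    then show ?thesis unfolding settles_def using finite_subset by blast
  qed
  moreover have "finite (S - R)" if S: "S \<in> C" for S
  proof -
    have "S - R \<subseteq> (\<Union>k\<in>{k. \<not> h S k \<le> g k}. {..<h S k})"
    proof
      fix p assume p: "p \<in> S - R"
      then obtain k where k: "g k \<le> p" "p \<notin> B k" by (auto simp: R_def)
      then have "p < h S k" using h[OF S, of k] p by auto
      with k have "\<not> h S k \<le> g k" by simp
      with \<open>p < h S k\<close> show "p \<in> (\<Union>k\<in>{k. \<not> h S k \<le> g k}. {..<h S k})" by blast
    qed
    moreover have "finite (\<Union>k\<in>{k. \<not> h S k \<le> g k}. {..<h S k})"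
      using g[OF S] by (auto simp: le_star_def)
    ultimately show ?thesis by (rule finite_subset)
  qed
  ultimately show thesis by (rule that)
qed

definition limit_closed :: "('a set \<times> 'a) set \<Rightarrow> 'a set \<Rightarrow> bool" where
  "limit_closed C P \<longleftrightarrow> (\<forall>(S, y)\<in>C. infinite (S \<inter> P) \<longrightarrow> y \<in> P)"

lemma limit_closedD: "limit_closed C P \<Longrightarrow> (S, y) \<in> C \<Longrightarrow> y \<notin> P \<Longrightarrow> finite (S \<inter> P)"
  unfolding limit_closed_def by blast

lemma limit_closed_insert:
  assumes "limit_closed C P" shows "limit_closed C (insert x P)"
proof -
  have "finite (S \<inter> insert x P)" if "finite (S \<inter> P)" for S
    using that by (simp add: Int_insert_right)
  then show ?thesis using assms unfolding limit_closed_def by blast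
qed

lemma limit_closed_Un_convergent:
  assumes P: "limit_closed C P" "y \<in> P"
    and R: "\<And>S z. (S, z) \<in> C \<Longrightarrow> infinite (S \<inter> R) \<Longrightarrow> z = y"
  shows "limit_closed C (P \<union> (R - Q))"
proof -
  have "z \<in> P" if Sz: "(S, z) \<in> C" "infinite (S \<inter> (P \<union> (R - Q)))" for S z
  proof -
    have "S \<inter> (P \<union> (R - Q)) \<subseteq> (S \<inter> P) \<union> (S \<inter> R)" by blast
    then have "infinite (S \<inter> P) \<or> infinite (S \<inter> R)"
      using Sz(2) by (meson finite_UnI finite_subset)
    then show ?thesis using P(2) R[OF Sz(1)] limit_closedD[OF P(1) Sz(1)] by blast
  qed
  then show ?thesis unfolding limit_closed_def by blast
qed

text \<open>\<open>P \<union> (R - Q)\<close> works: removing \<open>Q\<close> costs a sequence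
  promised to \<open>y\<close> only finitely many points, because \<open>Q\<close> is limit closed
  and misses \<open>y\<close>.\<close>

lemma limit_closed_extend:
  assumes P: "limit_closed C P" "y \<in> P" and Q: "limit_closed C Q" "P \<inter> Q = {}"
    and R: "\<And>S z. (S, z) \<in> C \<Longrightarrow> infinite (S \<inter> R) \<Longrightarrow> z = y"
    and fin: "\<And>S. (S, y) \<in> C \<Longrightarrow> finite (S - R)"
  shows "\<exists>P'. P \<subseteq> P' \<and> limit_closed C P' \<and> P' \<inter> Q = {} \<and> (\<forall>S. (S, y) \<in> C \<longrightarrow> finite (S - P'))"
proof (intro exI conjI allI impI)
  show "limit_closed C (P \<union> (R - Q))" by (rule limit_closed_Un_convergent[OF P R])
  fix S assume S: "(S, y) \<in> C"
  have "finite (S \<inter> Q)" using limit_closedD[OF Q(1) S] P(2) Q(2) by blast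
  then have "finite ((S - R) \<union> (S \<inter> Q))" using fin[OF S] by simp
  then show "finite (S - (P \<union> (R - Q)))" by (rule rev_finite_subset) blast
qed (use Q in auto)

text \<open>Disjoint limit closed sets \<open>P\<close> around \<open>P0\<close> and
  \<open>Q\<close> around \<open>x\<close> grow in countably many stages. Stage \<open>n\<close>
  puts \<open>n\<close> into \<open>P\<close> unless it is already in \<open>Q\<close>, and then
  absorbs into that side almost all of every sequence promised to \<open>n\<close>.\<close>

lemma clopen_separation:
  fixes C :: "(nat set \<times> nat) set" and V :: "nat \<Rightarrow> nat set"
  assumes small: "|C| <o bounding_number"
    and sep: "\<And>x y. x \<noteq> y \<Longrightarrow> \<exists>i. (x \<in> V i) \<noteq> (y \<in> V i)"
    and conv: "\<And>S y i. (S, y) \<in> C \<Longrightarrow> settles S y (V i)"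
    and P0: "limit_closed C P0" and x: "x \<notin> P0"
  obtains U where "x \<in> U" and "U \<inter> P0 = {}" and "\<And>S y. (S, y) \<in> C \<Longrightarrow> settles S y U"
proof -
  have "\<exists>R. (\<forall>i. settles R y (V i)) \<and> (\<forall>S. (S, y) \<in> C \<longrightarrow> finite (S - R))" for y
  proof -
    have "{S. (S, y) \<in> C} \<subseteq> fst ` C" by force
    then have "|{S. (S, y) \<in> C}| \<le>o |C|"
      by (rule ordLeq_transitive[OF card_of_mono1 card_of_image])
    then have "|{S. (S, y) \<in> C}| <o bounding_number"
      using small by (rule ordLeq_ordLess_trans)
    then show ?thesis
      by (rule convergent_hull[where V = V and y = y]) (use conv in auto)
  qed
  then obtain R where R: "\<And>y i. settles (R y) y (V i)"
    and fin: "\<And>y S. (S, y) \<in> C \<Longrightarrow> finite (S - R y)"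
    by metis
  \<comment> \<open>The \<open>V i\<close> separate points, so \<open>R y\<close> meets infinitely
    only sequences promised to \<open>y\<close>. Hence a side containing \<open>y\<close> can absorb
    it and stay limit closed.\<close>
  have lim: "z = y" if "(S, z) \<in> C" "infinite (S \<inter> R y)" for S y z
    using settles_both_imp_eq[of V, OF sep conv[OF that(1)] R that(2)] by blast
  define inv where "inv PQ \<longleftrightarrow> limit_closed C (fst PQ) \<and> limit_closed C (snd PQ) \<and>
      fst PQ \<inter> snd PQ = {} \<and> P0 \<subseteq> fst PQ \<and> x \<in> snd PQ" for PQ
  define next_pair where "next_pair n PQ PQ' \<longleftrightarrow> fst PQ \<subseteq> fst PQ' \<and> snd PQ \<subseteq> snd PQ' \<and>
      n \<in> fst PQ' \<union> snd PQ' \<and>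
      (\<forall>S. (S, n) \<in> C \<longrightarrow> finite (S - (if n \<in> snd PQ' then snd PQ' else fst PQ')))" for n PQ PQ'
  have "inv (P0, {x})"
    using P0 x limit_closed_insert[of C "{}" x] by (auto simp: inv_def limit_closed_def)
  moreover have "\<exists>PQ'. inv PQ' \<and> next_pair n PQ PQ'" if "inv PQ" for n PQ
  proof (cases "n \<in> snd PQ")
    case True
    obtain P Q where [simp]: "PQ = (P, Q)" by fastforce
    have "\<exists>Q'. Q \<subseteq> Q' \<and> limit_closed C Q' \<and> Q' \<inter> P = {} \<and> (\<forall>S. (S, n) \<in> C \<longrightarrow> finite (S - Q'))"
      by (rule limit_closed_extend[where R = "R n"]) (use that True lim fin in \<open>auto simp: inv_def\<close>)
    then obtain Q' where "Q \<subseteq> Q'" "limit_closed C Q'" "Q' \<inter> P = {}"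
      "\<forall>S. (S, n) \<in> C \<longrightarrow> finite (S - Q')" by blast
    then have "inv (P, Q') \<and> next_pair n PQ (P, Q')"
      using that True by (auto simp: inv_def next_pair_def)
    then show ?thesis by blast
  next
    case False
    obtain P Q where [simp]: "PQ = (P, Q)" by fastforce
    have "\<exists>P'. insert n P \<subseteq> P' \<and> limit_closed C P' \<and> P' \<inter> Q = {} \<and>
        (\<forall>S. (S, n) \<in> C \<longrightarrow> finite (S - P'))"
      by (rule limit_closed_extend[where R = "R n"])
        (use that False lim fin limit_closed_insert in \<open>auto simp: inv_def\<close>)
    then obtain P' where "insert n P \<subseteq> P'" "limit_closed C P'" "P' \<inter> Q = {}"
      "\<forall>S. (S, n) \<in> C \<longrightarrow> finite (S - P')" by blast
    then have "inv (P', Q) \<and> next_pair n PQ (P', Q)"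
      using that False by (auto simp: inv_def next_pair_def)
    then show ?thesis by blast
  qed
  ultimately obtain f where f: "\<And>n. inv (f n)" "\<And>n. next_pair n (f n) (f (Suc n))"
    using dependent_nat_choice[of "\<lambda>_. inv" next_pair] by blast
  have mono: "fst (f m) \<subseteq> fst (f n)" "snd (f m) \<subseteq> snd (f n)" if "m \<le> n" for m n
    by (rule lift_Suc_mono_le[of "\<lambda>n. fst (f n)"] lift_Suc_mono_le[of "\<lambda>n. snd (f n)"],
        use that f(2) in \<open>simp_all add: next_pair_def\<close>)+
  have disj: "fst (f m) \<inter> snd (f n) = {}" for m n
    using f(1)[of "max m n"] mono(1)[of m "max m n"] mono(2)[of n "max m n"]
    unfolding inv_def by auto
  \<comment> \<open>Stage \<open>n\<close> decides the point \<open>n\<close>, so the complement of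
    \<open>U\<close> is the union of the first components.\<close>
  define U where "U = (\<Union>n. snd (f n))"
  show thesis
  proof (rule that)
    show "x \<in> U" "U \<inter> P0 = {}"
      using f(1) unfolding U_def inv_def by blast+
    fix S y assume S: "(S, y) \<in> C"
    show "settles S y U"
    proof (cases "y \<in> snd (f (Suc y))")
      case True
      then have "finite (S - snd (f (Suc y)))" using f(2)[of y] S unfolding next_pair_def by simp
      then have "finite (S - U)" by (rule rev_finite_subset) (auto simp: U_def)
      then show ?thesis using True by (auto simp: settles_cases U_def)
    next
      case False
      then have y: "y \<in> fst (f (Suc y))" and "finite (S - fst (f (Suc y)))"
        using f(2)[of y] S unfolding next_pair_def by auto
      then have "finite (S \<inter> U)" using disj[of "Suc y"]
        by (elim rev_finite_subset) (auto simp: U_def)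
      moreover have "y \<notin> U" using y disj[of "Suc y"] by (auto simp: U_def)
      ultimately show ?thesis by (simp add: settles_cases)
    qed
  qed
qed

section \<open>Candidate sequences and their limit points\<close>

text \<open>The family of candidates for promised sequences. The last clause is a diagonal property
  with prescribed lower bounds \<open>g n\<close>; pieces \<open>F n\<close> may be empty, so some
  of the \<open>T n\<close> can be ignored.\<close>

definition selective :: "nat set set \<Rightarrow> bool" where
  "selective \<G> \<longleftrightarrow>
     (\<forall>T\<in>\<G>. infinite T) \<and> (\<forall>T\<in>\<G>. \<forall>S\<subseteq>T. infinite S \<longrightarrow> S \<in> \<G>) \<and>
     (\<forall>T g. (\<forall>n. T n \<in> \<G>) \<longrightarrow>
        (\<exists>F. (\<forall>n. finite (F n) \<and> F n \<subseteq> T n \<inter> {g n..}) \<and> (\<Union>n::nat. F n) \<in> \<G>))"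

definition limit_points :: "nat set set \<Rightarrow> nat set set \<Rightarrow> nat set \<Rightarrow> nat set" where
  "limit_points \<G> \<U> A = A \<union> {y. \<exists>T\<in>\<G>. T \<subseteq> A \<and> (\<forall>U\<in>\<U>. settles T y U)}"

text \<open>Smallness of \<open>\<U>\<close> makes limits of limits of \<open>A\<close> limits of \<open>A\<close>: far enough tails
  of the inner sequences follow their limits into every member of \<open>\<U>\<close>.\<close>

lemma limit_closed_limit_points:
  fixes C :: "(nat set \<times> nat) set"
  assumes sel: "selective \<G>" and small: "|\<U>| <o bounding_number"
    and C: "\<And>S x. (S, x) \<in> C \<Longrightarrow> S \<in> \<G>"
    and conv: "\<And>S x U. (S, x) \<in> C \<Longrightarrow> U \<in> \<U> \<Longrightarrow> settles S x U"
  shows "limit_closed C (limit_points \<G> \<U> A)"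
proof -
  have "x \<in> limit_points \<G> \<U> A" if Sx: "(S, x) \<in> C" and inf: "infinite (S \<inter> limit_points \<G> \<U> A)" for S x
  proof (cases "infinite (S \<inter> A)")
    case True
    then have "S \<inter> A \<in> \<G>" using sel C[OF Sx] unfolding selective_def by blast
    then show ?thesis
      using conv[OF Sx] settles_subset[of S x _ "S \<inter> A"] unfolding limit_points_def by blast
  next
    case False
    \<comment> \<open>Almost all the given points lie outside \<open>A\<close>, so they are limits
      of candidates \<open>T n\<close> inside \<open>A\<close>, from which a candidate for
      \<open>x\<close> is assembled.\<close>
    define B where "B = S \<inter> limit_points \<G> \<U> A - A"
    have "S \<inter> limit_points \<G> \<U> A \<subseteq> B \<union> (S \<inter> A)" by (auto simp: B_def)
    then have infB: "infinite B" using inf False by (meson finite_UnI finite_subset)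
    define y where "y = enumerate B"
    have y: "y n \<in> B" and injy: "inj y" for n
      using enumerate_in_set[OF infB] infB
      by (auto simp: y_def intro: strict_mono_imp_inj_on strict_mono_enumerate)
    have "\<forall>n. \<exists>T. T \<in> \<G> \<and> T \<subseteq> A \<and> (\<forall>U\<in>\<U>. settles T (y n) U)"
      using y unfolding B_def limit_points_def by blast
    then obtain T where T: "\<And>n. T n \<in> \<G>" "\<And>n. T n \<subseteq> A" "\<And>n U. U \<in> \<U> \<Longrightarrow> settles (T n) (y n) U"
      by metis
    have "\<forall>U n. \<exists>m. U \<in> \<U> \<longrightarrow> {t \<in> T n. (t \<in> U) \<noteq> (y n \<in> U)} \<subseteq> {..<m}"
      using T(3) finite_nat_iff_bounded unfolding settles_def by metis
    then obtain h where h: "\<And>U n. U \<in> \<U> \<Longrightarrow> {t \<in> T n. (t \<in> U) \<noteq> (y n \<in> U)} \<subseteq> {..<h U n}"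
      by metis
    obtain g where g: "\<And>U. U \<in> \<U> \<Longrightarrow> le_star (h U) g"
      using bounded_if_less_bounding_number[OF small] by blast
    obtain F where F: "\<And>n. finite (F n)" "\<And>n. F n \<subseteq> T n \<inter> {g n..}" "(\<Union>n. F n) \<in> \<G>"
      using sel T(1) unfolding selective_def by metis
    have "settles (\<Union>n. F n) x U" if U: "U \<in> \<U>" for U
    proof -
      \<comment> \<open>Outside \<open>N\<close>, the part of \<open>T n\<close> beyond
        \<open>g n\<close> follows \<open>y n\<close>, and \<open>y n\<close> follows
        \<open>x\<close>. Only the finitely many finite pieces \<open>F n\<close> with
        \<open>n\<close> in \<open>N\<close> can stray.\<close>
      define N where "N = {n. \<not> h U n \<le> g n} \<union> {n. (y n \<in> U) \<noteq> (x \<in> U)}"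
      have "y ` {n. (y n \<in> U) \<noteq> (x \<in> U)} \<subseteq> {t \<in> S. (t \<in> U) \<noteq> (x \<in> U)}"
        using y by (auto simp: B_def)
      then have "finite (y ` {n. (y n \<in> U) \<noteq> (x \<in> U)})"
        using conv[OF Sx U] finite_subset unfolding settles_def by blast
      then have "finite {n. (y n \<in> U) \<noteq> (x \<in> U)}"
        using finite_imageD inj_on_subset[OF injy] by blast
      then have "finite N" using g[OF U] by (simp add: N_def le_star_def)
      have "{t \<in> \<Union>n. F n. (t \<in> U) \<noteq> (x \<in> U)} \<subseteq> (\<Union>n\<in>N. F n)"
      proof
        fix t assume "t \<in> {t \<in> \<Union>n. F n. (t \<in> U) \<noteq> (x \<in> U)}"
        then obtain n where n: "t \<in> F n" "(t \<in> U) \<noteq> (x \<in> U)" by blast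
        have "n \<in> N"
        proof (rule ccontr)
          assume "n \<notin> N"
          then have "h U n \<le> g n" "(y n \<in> U) = (x \<in> U)" by (auto simp: N_def)
          moreover have "t \<in> T n" "g n \<le> t" using F(2)[of n] n(1) by auto
          ultimately show False using h[OF U, of n] n(2) by auto
        qed
        with n show "t \<in> (\<Union>n\<in>N. F n)" by blast
      qed
      then show ?thesis
        unfolding settles_def by (rule finite_subset) (use \<open>finite N\<close> F(1) in blast)
    qed
    moreover have "(\<Union>n. F n) \<subseteq> A" using F(2) T(2) by blast
    ultimately show ?thesis using F(3) unfolding limit_points_def by blast
  qed
  then show ?thesis unfolding limit_closed_def by blast
qed

section \<open>A single step of the recursion\<close>

text \<open>A partial construction is a set of entries \<open>Inl (T, x)\<close>, a sequence promised to converge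
  to \<open>x\<close>, and \<open>Inr U\<close>, a set promised to be clopen.\<close>

definition compatible :: "('a set \<times> 'a) + 'a set \<Rightarrow> ('a set \<times> 'a) + 'a set \<Rightarrow> bool" where
  "compatible e e' \<longleftrightarrow> (\<forall>T x U. (e = Inl (T, x) \<and> e' = Inr U) \<or> (e' = Inl (T, x) \<and> e = Inr U) \<longrightarrow>
     settles T x U)"

lemma compatible_sym: "compatible e e' \<Longrightarrow> compatible e' e"
  unfolding compatible_def by blast

lemma compatible_refl: "compatible e e"
  unfolding compatible_def by auto

text \<open>The alternatives are those of the Frechet property for \<open>A\<close> at
  \<open>x\<close>: a constant sequence, a convergent sequence in \<open>A\<close>, or a
  neighbourhood keeping \<open>x\<close> out of the closure.\<close>

definition decides :: "'a set \<times> 'a \<Rightarrow> ('a set \<times> 'a) + 'a set \<Rightarrow> bool" where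
  "decides Ax e \<longleftrightarrow> snd Ax \<in> fst Ax \<or> (\<exists>T\<subseteq>fst Ax. e = Inl (T, snd Ax)) \<or>
     (\<exists>U. e = Inr U \<and> snd Ax \<in> U \<and> U \<inter> fst Ax = {})"

text \<open>If \<open>x\<close> is a limit point of \<open>A\<close>, the witnessing candidate
  respects all earlier clopen sets by definition. If not, the limit points form a limit closed set,
  which \<open>clopen_separation\<close> separates from \<open>x\<close>.\<close>

lemma decision_step:
  fixes D :: "((nat set \<times> nat) + nat set) set" and V :: "nat \<Rightarrow> nat set"
  assumes sel: "selective \<G>" and small: "|D| <o bounding_number"
    and D: "\<And>T x. Inl (T, x) \<in> D \<Longrightarrow> T \<in> \<G>"
    and comp: "\<And>d e. d \<in> D \<Longrightarrow> e \<in> D \<Longrightarrow> compatible d e"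
    and sep: "\<And>x y. x \<noteq> y \<Longrightarrow> \<exists>i. (x \<in> V i) \<noteq> (y \<in> V i)"
    and V: "\<And>i. Inr (V i) \<in> D"
  shows "\<exists>e. (\<forall>d\<in>D. compatible e d) \<and> (\<forall>T y. e = Inl (T, y) \<longrightarrow> T \<in> \<G>) \<and> decides (A, x) e"
proof -
  define C where "C = Inl -` D"
  define \<U> where "\<U> = Inr -` D"
  have "|C| \<le>o |Inl ` C :: ((nat set \<times> nat) + nat set) set|" "|\<U>| \<le>o |Inr ` \<U> :: ((nat set \<times> nat) + nat set) set|"
    by (rule card_of_ordLeqI[of Inl] card_of_ordLeqI[of Inr]; auto)+
  moreover have "Inl ` C \<subseteq> D" "Inr ` \<U> \<subseteq> D" by (auto simp: C_def \<U>_def)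
  ultimately have "|C| \<le>o |D|" "|\<U>| \<le>o |D|"
    by (meson card_of_mono1 ordLeq_transitive)+
  then have smallC: "|C| <o bounding_number" and smallU: "|\<U>| <o bounding_number"
    using small by (blast intro: ordLeq_ordLess_trans)+
  have conv: "settles S y U" if "(S, y) \<in> C" "U \<in> \<U>" for S y U
    using comp[of "Inl (S, y)" "Inr U"] that unfolding C_def \<U>_def compatible_def by blast
  have lc: "limit_closed C (limit_points \<G> \<U> A)"
    by (rule limit_closed_limit_points[OF sel smallU]) (use D conv in \<open>auto simp: C_def\<close>)
  show ?thesis
  proof (cases "x \<in> limit_points \<G> \<U> A")
    case True
    then consider "x \<in> A" | T where "T \<in> \<G>" "T \<subseteq> A" "\<forall>U\<in>\<U>. settles T x U"
      unfolding limit_points_def by blast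
    then show ?thesis
    proof cases
      case 1
      \<comment> \<open>\<open>Inr UNIV\<close> is a vacuous promise, used when there is nothing to
        decide.\<close>
      then show ?thesis by (intro exI[of _ "Inr UNIV"]) (auto simp: compatible_def decides_def)
    next
      case 2
      then show ?thesis
        by (intro exI[of _ "Inl (T, x)"]) (auto simp: compatible_def decides_def \<U>_def)
    qed
  next
    case False
    have "settles S y (V i)" if "(S, y) \<in> C" for S y i
      using conv[OF that, of "V i"] V by (simp add: \<U>_def)
    then obtain U where "x \<in> U" "U \<inter> limit_points \<G> \<U> A = {}" "\<And>S y. (S, y) \<in> C \<Longrightarrow> settles S y U"
      using clopen_separation[OF smallC sep _ lc False] by blast
    then show ?thesis
      by (intro exI[of _ "Inr U"]) (auto simp: compatible_def decides_def C_def limit_points_def)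
  qed
qed

lemma card_nat_set_times_nat: "|UNIV :: (nat set \<times> nat) set| \<le>o continuum"
proof -
  have "|UNIV :: (nat set \<times> nat) set| =o |UNIV :: nat set set|"
  proof -
    have "|UNIV :: nat set| \<le>o |UNIV :: nat set set|"
      by (rule card_of_ordLeqI[of "\<lambda>n. {n}"]) (auto simp: inj_on_def)
    then have "|(UNIV :: nat set set) \<times> (UNIV :: nat set)| =o |UNIV :: nat set set|"
      by (intro card_of_Times_infinite_simps(1)) (auto simp: Finite_Set.finite_set)
    then show ?thesis by (simp add: UNIV_Times_UNIV)
  qed
  moreover have "|UNIV :: nat set set| \<le>o |Func (UNIV :: nat set) (UNIV :: bool set)|"
    by (rule card_of_ordLeqI[of "\<lambda>A n. n \<in> A"]) (auto simp: inj_on_def Func_def fun_eq_iff)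
  ultimately show ?thesis
    unfolding continuum_def cexp_def ctwo_def
    by (simp add: Field_card_of Field_natLeq ordIso_ordLeq_trans)
qed

section \<open>The transfinite construction\<close>

text \<open>The recursion follows a cardinal order \<open>r\<close> on the pairs
  \<open>(A, x)\<close>. Proper initial segments are smaller than the continuum, hence than the
  bounding number, so \<open>decision_step\<close> applies at every stage; \<open>E\<close> holds
  the initial promises.\<close>

lemma complete_construction:
  fixes V :: "nat \<Rightarrow> nat set"
  assumes bc: "bounding_number =o continuum" and sel: "selective \<G>"
    and C0: "countable C\<^sub>0" "\<And>S x. (S, x) \<in> C\<^sub>0 \<Longrightarrow> S \<in> \<G>"
    and sep: "\<And>x y. x \<noteq> y \<Longrightarrow> \<exists>i. (x \<in> V i) \<noteq> (y \<in> V i)"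
    and conv: "\<And>S x i. (S, x) \<in> C\<^sub>0 \<Longrightarrow> settles S x (V i)"
  obtains D where "Inl ` C\<^sub>0 \<subseteq> D" and "range (\<lambda>i. Inr (V i)) \<subseteq> D"
    and "\<forall>T x. Inl (T, x) \<in> D \<longrightarrow> T \<in> \<G>"
    and "\<forall>d\<in>D. \<forall>e\<in>D. compatible d e" and "\<forall>A x. \<exists>e\<in>D. decides (A, x) e"
proof -
  define E where "E = Inl ` C\<^sub>0 \<union> Inr ` range V"
  define r where "r = |UNIV :: (nat set \<times> nat) set|"
  have r: "Card_order r" "Well_order r" "Field r = UNIV"
    unfolding r_def by (rule card_of_Card_order card_of_Well_order Field_card_of)+
  define D where "D f i = E \<union> f ` underS r i" for f :: "nat set \<times> nat \<Rightarrow> (nat set \<times> nat) + nat set" and i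
  define P where "P f i e \<longleftrightarrow> (\<forall>d\<in>D f i. compatible e d) \<and>
     (\<forall>T y. e = Inl (T, y) \<longrightarrow> T \<in> \<G>) \<and> decides i e" for f i e
  have E: "compatible d e" if "d \<in> E" "e \<in> E" for d e
    using that conv unfolding E_def compatible_def by blast
  \<comment> \<open>Of two different stages, the later one was chosen compatible with the
    earlier.\<close>
  have chain: "compatible (f i) (f j)" if "P f i (f i)" "P f j (f j)" for f i j
  proof -
    have "total_on UNIV r" using r(2,3) by (simp add: well_order_on_def linear_order_on_def)
    then have "i = j \<or> i \<in> underS r j \<or> j \<in> underS r i"
      unfolding underS_def total_on_def by blast
    then show ?thesis
      using that unfolding P_def D_def by (auto intro: compatible_sym compatible_refl)
  qed
  have "\<exists>f. \<forall>i. P f i (f i)"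
  proof (rule dependent_wf_choice[of "r - Id"])
    show "wf (r - Id)" using r(2) unfolding well_order_on_def by blast
  next
    fix f g :: "nat set \<times> nat \<Rightarrow> (nat set \<times> nat) + nat set" and i e
    assume "\<And>j. (j, i) \<in> r - Id \<Longrightarrow> f j = g j"
    then have "D f i = D g i" unfolding D_def underS_def by force
    then show "P f i e = P g i e" unfolding P_def by simp
  next
    fix i and f :: "nat set \<times> nat \<Rightarrow> (nat set \<times> nat) + nat set"
    assume IH: "\<And>j. (j, i) \<in> r - Id \<Longrightarrow> P f j (f j)"
    then have IH: "P f j (f j)" if "j \<in> underS r i" for j
      using that by (auto simp: underS_def)
    obtain A x where i: "i = (A, x)" by fastforce
    have inf: "infinite (UNIV :: (nat set \<times> nat) set)"
      by (simp add: finite_prod)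
    have "|f ` underS r i| <o r"
      by (rule ordLeq_ordLess_trans[OF card_of_image card_of_underS[OF r(1)]]) (simp add: r(3))
    moreover have "|E| <o r"
    proof -
      have "countable E" using C0(1) by (auto simp: E_def)
      then have "|E| \<le>o |UNIV :: nat set|" unfolding countable_def by (blast intro: card_of_ordLeqI)
      also have "|UNIV :: nat set| <o |UNIV :: nat set set|"
        using card_of_Pow[of "UNIV :: nat set"] by simp
      also have "|UNIV :: nat set set| \<le>o r"
        unfolding r_def by (rule card_of_ordLeqI[of "\<lambda>A. (A, 0)"]) (auto simp: inj_on_def)
      finally show ?thesis .
    qed
    ultimately have "|D f i| <o r"
      unfolding D_def using card_of_Un_ordLess_infinite[OF inf] by (simp add: r_def)
    moreover have "r \<le>o bounding_number"
      unfolding r_def by (rule ordLeq_ordIso_trans[OF card_nat_set_times_nat ordIso_symmetric[OF bc]])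
    ultimately have "|D f i| <o bounding_number" by (rule ordLess_ordLeq_trans)
    then have "\<exists>e. (\<forall>d\<in>D f i. compatible e d) \<and> (\<forall>T y. e = Inl (T, y) \<longrightarrow> T \<in> \<G>) \<and> decides (A, x) e"
    proof (rule decision_step[OF sel _ _ _ sep])
      fix T x assume "Inl (T, x) \<in> D f i"
      then consider "(T, x) \<in> C\<^sub>0" | j where "j \<in> underS r i" "f j = Inl (T, x)"
        by (auto simp: D_def E_def)
      then show "T \<in> \<G>"
      proof cases
        case 2
        then show ?thesis using IH[OF 2(1)] by (simp add: P_def)
      qed (rule C0(2))
    next
      fix d e assume "d \<in> D f i" "e \<in> D f i"
      moreover have "compatible (f j) d" if "d \<in> E" "j \<in> underS r i" for j d
        using IH[OF that(2)] that(1) by (simp add: P_def D_def)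
      moreover have "compatible (f j) (f k)" if "j \<in> underS r i" "k \<in> underS r i" for j k
        using chain IH that by blast
      ultimately show "compatible d e"
        using E unfolding D_def by (blast intro: compatible_sym)
    qed (auto simp: D_def E_def)
    then show "\<exists>e. P f i e" unfolding P_def i by blast
  qed
  then obtain f where f: "\<And>i. P f i (f i)" by blast
  show thesis
  proof (rule that[of "E \<union> range f"])
    have "T \<in> \<G>" if "Inl (T, x) \<in> E \<union> range f" for T x
    proof -
      from that consider "(T, x) \<in> C\<^sub>0" | j where "f j = Inl (T, x)"
        by (auto simp: E_def)
      then show ?thesis
      proof cases
        case 2
        then show ?thesis using f[of j] by (simp add: P_def)
      qed (rule C0(2))
    qed
    then show "\<forall>T x. Inl (T, x) \<in> E \<union> range f \<longrightarrow> T \<in> \<G>" by blast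
    have "compatible (f i) d" if "d \<in> E" for i d using f[of i] that by (simp add: P_def D_def)
    then show "\<forall>d\<in>E \<union> range f. \<forall>e\<in>E \<union> range f. compatible d e"
      using E chain[OF f f] by (blast intro: compatible_sym)
    show "\<forall>A x. \<exists>e\<in>E \<union> range f. decides (A, x) e" using f unfolding P_def by blast
  qed (auto simp: E_def)
qed

section \<open>The space with prescribed convergent sequences\<close>

text \<open>Complements make the members clopen; \<open>UNIV\<close> keeps the carrier right even
  for empty \<open>\<U>\<close>.\<close>

definition clopen_topology :: "'a set set \<Rightarrow> 'a topology" where
  "clopen_topology \<U> = topology_generated_by (insert UNIV (\<U> \<union> uminus ` \<U>))"

lemma topspace_clopen_topology [simp]: "topspace (clopen_topology \<U>) = UNIV"
  by (simp add: clopen_topology_def)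

lemma clopen_in_clopen_topology:
  assumes "U \<in> \<U>"
  shows "openin (clopen_topology \<U>) U" and "closedin (clopen_topology \<U>) U"
    and "openin (clopen_topology \<U>) (- U)"
  using assms unfolding closedin_def
  by (auto simp: clopen_topology_def Compl_eq_Diff_UNIV[symmetric]
      intro!: topology_generated_by_Basis)

text \<open>For a fixed \<open>x\<close>, a union reduces to one member containing \<open>x\<close>,
  followed by enlargement. So upward closed properties preserved by intersections need checking only
  on subbasic sets.\<close>

lemma clopen_topology_induct [consumes 2, case_names UNIV Int basis compl mono]:
  assumes "openin (clopen_topology \<U>) W" and "x \<in> W"
    and "Q UNIV" and "\<And>A B. Q A \<Longrightarrow> Q B \<Longrightarrow> Q (A \<inter> B)"
    and "\<And>U. U \<in> \<U> \<Longrightarrow> x \<in> U \<Longrightarrow> Q U" and "\<And>U. U \<in> \<U> \<Longrightarrow> x \<notin> U \<Longrightarrow> Q (- U)"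
    and "\<And>A B. Q A \<Longrightarrow> A \<subseteq> B \<Longrightarrow> Q B"
  shows "Q W"
proof -
  have "generate_topology_on (insert UNIV (\<U> \<union> uminus ` \<U>)) W"
    using assms(1) by (simp add: clopen_topology_def openin_topology_generated_by_iff)
  then show ?thesis using assms(2)
  proof induction
    case (UN K)
    then obtain k where "k \<in> K" "Q k" by blast
    then show ?case using assms(7) by blast
  qed (use assms(3-6) in auto)
qed

lemma settles_clopen_topology:
  assumes "openin (clopen_topology \<U>) W" and "x \<in> W" and "\<And>U. U \<in> \<U> \<Longrightarrow> settles T x U"
  shows "finite (T - W)"
  using assms(1,2)
proof (induction rule: clopen_topology_induct)
  case (Int A B)
  then show ?case by (simp add: Diff_Int)
next
  case (basis U)
  then show ?case using assms(3)[of U] by (simp add: settles_cases)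
next
  case (compl U)
  then show ?case using assms(3)[of U] by (simp add: settles_cases Diff_Compl)
next
  case (mono A B)
  then show ?case by (meson Diff_mono finite_subset subset_refl)
qed simp

lemma regular_clopen_topology: "regular_space (clopen_topology \<U>)"
proof -
  let ?X = "clopen_topology \<U>"
  \<comment> \<open>Zero-dimensionality: a clopen \<open>K\<close> and its complement then witness
    regularity.\<close>
  have clopen_base: "\<exists>K. openin ?X K \<and> closedin ?X K \<and> x \<in> K \<and> K \<subseteq> W" if "openin ?X W" "x \<in> W" for W x
    using that
  proof (induction rule: clopen_topology_induct)
    case UNIV
    show ?case using openin_topspace[of ?X] closedin_topspace[of ?X] by auto
  next
    case (Int A B)
    then show ?case by (metis IntI openin_Int closedin_Int Int_mono)
  next
    case (basis U)
    then show ?case using clopen_in_clopen_topology by blast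
  next
    case (compl U)
    then show ?case
      using clopen_in_clopen_topology(1,3)[OF compl(1)]
      by (intro exI[of _ "- U"]) (simp add: closedin_def Compl_eq_Diff_UNIV[symmetric])
  qed blast
  show ?thesis
    unfolding regular_space_def
  proof (intro allI impI)
    fix C a assume C: "closedin ?X C \<and> a \<in> topspace ?X - C"
    then obtain K where "openin ?X K" "closedin ?X K" "a \<in> K" "K \<subseteq> UNIV - C"
      using clopen_base[of "UNIV - C" a] by (auto simp: closedin_def)
    then show "\<exists>U V. openin ?X U \<and> openin ?X V \<and> a \<in> U \<and> C \<subseteq> V \<and> disjnt U V"
      by (intro exI[of _ K] exI[of _ "UNIV - K"]) (auto simp: closedin_def disjnt_def)
  qed
qed

lemma Hausdorff_clopen_topology:
  assumes "\<And>x y. x \<noteq> y \<Longrightarrow> \<exists>U\<in>\<U>. (x \<in> U) \<noteq> (y \<in> U)"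
  shows "Hausdorff_space (clopen_topology \<U>)"
  unfolding Hausdorff_space_def
proof (intro allI impI)
  fix x y assume "x \<in> topspace (clopen_topology \<U>) \<and> y \<in> topspace (clopen_topology \<U>) \<and> x \<noteq> y"
  then obtain U where U: "U \<in> \<U>" "(x \<in> U) \<noteq> (y \<in> U)" using assms by blast
  then show "\<exists>A B. openin (clopen_topology \<U>) A \<and> openin (clopen_topology \<U>) B \<and> x \<in> A \<and> y \<in> B \<and> disjnt A B"
    using clopen_in_clopen_topology(1,3)[OF U(1)]
    by (cases "x \<in> U") (auto simp: disjnt_def intro: exI[of _ U] exI[of _ "- U"])
qed

text \<open>Every closure in the constructed space is witnessed by a member of \<open>\<G>\<close>; this gives both the
  Frechet property and the discreteness of the sets orthogonal to \<open>\<G>\<close>.\<close>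

lemma selective_space:
  fixes V :: "nat \<Rightarrow> nat set"
  assumes bc: "bounding_number =o continuum" and sel: "selective \<G>"
    and C0: "countable C\<^sub>0" "\<And>S x. (S, x) \<in> C\<^sub>0 \<Longrightarrow> S \<in> \<G>"
    and sep: "\<And>x y. x \<noteq> y \<Longrightarrow> \<exists>i. (x \<in> V i) \<noteq> (y \<in> V i)"
    and conv: "\<And>S x i. (S, x) \<in> C\<^sub>0 \<Longrightarrow> settles S x (V i)"
  obtains X where "topspace X = UNIV" "regular_space X" "Hausdorff_space X" "frechet_urysohn_space X"
    and "\<forall>(S, x)\<in>C\<^sub>0. \<forall>W. openin X W \<and> x \<in> W \<longrightarrow> finite (S - W)"
    and "\<forall>A x. (\<forall>T\<in>\<G>. finite (T \<inter> A)) \<longrightarrow> (\<exists>W. openin X W \<and> x \<in> W \<and> W \<inter> A \<subseteq> {x})"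
proof -
  obtain D where D0: "Inl ` C\<^sub>0 \<subseteq> D" and DV: "range (\<lambda>i. Inr (V i)) \<subseteq> D"
    and DG: "\<forall>T x. Inl (T, x) \<in> D \<longrightarrow> T \<in> \<G>"
    and comp: "\<forall>d\<in>D. \<forall>e\<in>D. compatible d e" and dec: "\<forall>A x. \<exists>e\<in>D. decides (A, x) e"
    by (rule complete_construction[OF assms])
  define \<U> where "\<U> = Inr -` D"
  let ?X = "clopen_topology \<U>"
  have inf: "infinite T" if "T \<in> \<G>" for T using sel that unfolding selective_def by blast
  have tail: "finite (T - W)" if "Inl (T, x) \<in> D" "openin ?X W" "x \<in> W" for T x W
    using that(2,3)
  proof (rule settles_clopen_topology)
    fix U assume "U \<in> \<U>"
    then show "settles T x U"
      using comp that(1) unfolding \<U>_def compatible_def by blast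
  qed
  have lim: "x \<in> A \<or> (\<exists>T\<subseteq>A. Inl (T, x) \<in> D) \<or> (\<exists>U. openin ?X U \<and> x \<in> U \<and> U \<inter> A = {})" for A x
  proof -
    obtain e where "e \<in> D" "decides (A, x) e" using dec by blast
    then show ?thesis
      unfolding decides_def using clopen_in_clopen_topology(1)[of _ \<U>] by (auto simp: \<U>_def)
  qed
  show thesis
  proof (rule that[of ?X])
    show "Hausdorff_space ?X"
    proof (rule Hausdorff_clopen_topology)
      fix x y :: nat assume "x \<noteq> y"
      then obtain i where "(x \<in> V i) \<noteq> (y \<in> V i)" using sep by blast
      then show "\<exists>U\<in>\<U>. (x \<in> U) \<noteq> (y \<in> U)" using DV by (intro bexI[of _ "V i"]) (auto simp: \<U>_def)
    qed
    show "frechet_urysohn_space ?X"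
      unfolding frechet_urysohn_space_def
    proof (intro allI impI)
      fix A x assume Ax: "A \<subseteq> topspace ?X \<and> x \<in> ?X closure_of A"
      then have "\<not> (\<exists>U. openin ?X U \<and> x \<in> U \<and> U \<inter> A = {})"
        unfolding closure_of_def by blast
      then consider "x \<in> A" | T where "T \<subseteq> A" "Inl (T, x) \<in> D" using lim by blast
      then show "\<exists>s. range s \<subseteq> A \<and> limitin ?X s x sequentially"
      proof cases
        case 1
        then show ?thesis by (intro exI[of _ "\<lambda>_. x"]) (auto simp: limitin_def)
      next
        case 2
        have T: "infinite T" using inf DG 2 by blast
        have "limitin ?X (enumerate T) x sequentially"
          unfolding limitin_def
        proof (intro conjI allI impI)
          fix W assume W: "openin ?X W \<and> x \<in> W"
          have "finite (enumerate T -` (T - W))"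
            using tail[OF 2(2)] W T by (intro finite_vimageI strict_mono_imp_inj_on strict_mono_enumerate) auto
          then have "finite {n. enumerate T n \<notin> W}"
            by (rule rev_finite_subset) (use enumerate_in_set[OF T] in auto)
          then show "\<forall>\<^sub>F n in sequentially. enumerate T n \<in> W"
            by (simp add: cofinite_eq_sequentially[symmetric] eventually_cofinite)
        qed simp
        moreover have "range (enumerate T) \<subseteq> A" using 2(1) enumerate_in_set[OF T] by blast
        ultimately show ?thesis by blast
      qed
    qed
    show "\<forall>(S, x)\<in>C\<^sub>0. \<forall>W. openin ?X W \<and> x \<in> W \<longrightarrow> finite (S - W)"
      using tail D0 by blast
    show "\<forall>A x. (\<forall>T\<in>\<G>. finite (T \<inter> A)) \<longrightarrow> (\<exists>W. openin ?X W \<and> x \<in> W \<and> W \<inter> A \<subseteq> {x})"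
    proof (intro allI impI)
      fix A x assume A: "\<forall>T\<in>\<G>. finite (T \<inter> A)"
      \<comment> \<open>A sequence promised inside \<open>A - {x}\<close> would be an infinite
        member of \<open>\<G>\<close> within \<open>A\<close>. Deleting \<open>x\<close> also
        excludes the first alternative of \<open>lim\<close>, so a neighbourhood remains.\<close>
      have "\<not> (\<exists>T\<subseteq>A - {x}. Inl (T, x) \<in> D)"
      proof (intro notI, elim exE conjE)
        fix T assume T: "T \<subseteq> A - {x}" "Inl (T, x) \<in> D"
        then have "T \<inter> A = T" "T \<in> \<G>" using DG by blast+
        then show False using A inf by fastforce
      qed
      then show "\<exists>W. openin ?X W \<and> x \<in> W \<and> W \<inter> A \<subseteq> {x}" using lim[of x "A - {x}"] by blast
    qed
  qed (simp_all add: regular_clopen_topology)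
qed

section \<open>Sequences from a tight gap\<close>

lemma
  assumes "tight_gap \<I> \<J>"
  shows tight_gap_orthogonal: "A \<in> \<I> \<Longrightarrow> B \<in> \<J> \<Longrightarrow> finite (A \<inter> B)"
    and tight_gap_down_graph: "A \<in> \<I> \<union> \<J> \<Longrightarrow> \<exists>f. A \<subseteq> down_graph f"
    and tight_gap_subset: "B \<in> \<J> \<Longrightarrow> C \<subseteq> B \<Longrightarrow> C \<in> \<J>"
  using assms by (simp_all add: tight_gap_def orthogonal_families_def set_ideal_def)

lemma tight_gap_splitting:
  assumes "tight_gap \<I> \<J>"
  obtains a b where "\<forall>f. a f \<in> \<I> \<and> b f \<in> \<J> \<and> down_graph f = a f \<union> b f"
    and "\<forall>X. infinite {n. infinite (X \<inter> ({n} \<times> UNIV))} \<longrightarrow>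
      (\<exists>f. infinite (X \<inter> a f) \<and> infinite (X \<inter> b f))"
  using assms unfolding tight_gap_def by (elim conjE exE)

lemma tight_gap_commute:
  assumes gap: "tight_gap \<I> \<J>"
  shows "tight_gap \<J> \<I>"
proof -
  obtain a b where "\<forall>f. a f \<in> \<I> \<and> b f \<in> \<J> \<and> down_graph f = a f \<union> b f"
    and "\<forall>X. infinite {n. infinite (X \<inter> ({n} \<times> UNIV))} \<longrightarrow>
      (\<exists>f. infinite (X \<inter> a f) \<and> infinite (X \<inter> b f))"
    by (rule tight_gap_splitting[OF gap])
  then have "\<exists>b a. (\<forall>f. b f \<in> \<J> \<and> a f \<in> \<I> \<and> down_graph f = b f \<union> a f) \<and>
      (\<forall>X. infinite {n. infinite (X \<inter> ({n} \<times> UNIV))} \<longrightarrow>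
        (\<exists>f. infinite (X \<inter> b f) \<and> infinite (X \<inter> a f)))"
    by (intro exI[of _ b] exI[of _ a]) (simp add: Un_commute conj_commute)
  moreover have "orthogonal_families \<J> \<I>"
    using tight_gap_orthogonal[OF gap] unfolding orthogonal_families_def by (metis Int_commute)
  ultimately show ?thesis
    using gap by (simp only: tight_gap_def Un_commute[of \<J>] simp_thms) (elim conjE)
qed

definition gap_sequences :: "(nat \<times> nat) set set \<Rightarrow> nat set set" where
  "gap_sequences \<I> = {T. infinite T \<and>
     (prod_decode ` T \<in> \<I> \<or> (\<exists>k. \<forall>p\<in>T. fst (prod_decode p) = k))}"

lemma finite_down_graph_columns:
  fixes f :: "'a \<Rightarrow> nat"
  assumes "finite K" shows "finite {(n, m). n \<in> K \<and> m < f n}"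
proof -
  have "{(n, m). n \<in> K \<and> m < f n} = Sigma K (\<lambda>n. {..<f n})" by auto
  then show ?thesis using assms by simp
qed

lemma infinite_if_unbounded_choice:
  fixes t :: "nat \<Rightarrow> nat"
  assumes "infinite N" and "\<And>n. n \<in> N \<Longrightarrow> n \<le> t n"
  shows "infinite (t ` N)"
proof
  assume "finite (t ` N)"
  then obtain m where "\<And>n. n \<in> N \<Longrightarrow> t n < m" by (auto simp: finite_nat_iff_bounded)
  then have "N \<subseteq> {..<m}" using assms(2) by (meson lessThan_iff order.strict_trans1 subsetI)
  then show False using assms(1) finite_subset by blast
qed

lemma infinite_nat_choice_above:
  fixes B :: "nat \<Rightarrow> nat set"
  assumes "\<And>n. n \<in> N \<Longrightarrow> infinite (B n)"
  obtains t where "\<And>n. n \<in> N \<Longrightarrow> t n \<in> B n" "\<And>n. n \<in> N \<Longrightarrow> g n \<le> t n" "\<And>n. n \<in> N \<Longrightarrow> n \<le> t n"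
proof -
  have "\<forall>n. \<exists>m. n \<in> N \<longrightarrow> m \<in> B n \<and> max (g n) n \<le> m"
    using assms by (metis infinite_nat_iff_unbounded_le)
  then show thesis using that by (metis max.bounded_iff)
qed

lemma eventual_bound_of_sequence:
  fixes f :: "nat \<Rightarrow> nat \<Rightarrow> nat"
  obtains g where "\<And>n m. n \<le> m \<Longrightarrow> f n m \<le> g m"
proof
  show "f n m \<le> (\<Sum>i\<le>m. f i m)" if "n \<le> m" for n m
    by (rule member_le_sum) (use that in auto)
qed

text \<open>If infinitely many \<open>T n\<close> come from \<open>\<I>\<close>, one graph
  \<open>h\<close> covers each of them modulo finite; \<open>a h\<close> meets them finitely, so
  single points from \<open>b h\<close> suffice. Otherwise infinitely many \<open>T n\<close> lie in
  columns. If finitely many columns occur, single points from one column suffice; if infinitely many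
  occur, tightness is used.\<close>

lemma selective_gap_sequences:
  assumes gap: "tight_gap \<I>' \<I>"
  shows "selective (gap_sequences \<I>)"
proof -
  obtain a b where splitting: "\<forall>f. a f \<in> \<I>' \<and> b f \<in> \<I> \<and> down_graph f = a f \<union> b f"
    and tight: "\<forall>X. infinite {n. infinite (X \<inter> ({n} \<times> UNIV))} \<longrightarrow>
      (\<exists>f. infinite (X \<inter> a f) \<and> infinite (X \<inter> b f))"
    by (rule tight_gap_splitting[OF gap])
  then have ab: "a f \<in> \<I>'" "b f \<in> \<I>" "down_graph f = a f \<union> b f" for f by simp_all
  note sub = tight_gap_subset[OF gap]
  have inj: "inj_on prod_decode T" for T by (rule inj_prod_decode)
  have sel: "\<exists>F. (\<forall>n. finite (F n) \<and> F n \<subseteq> T n \<inter> {g n..}) \<and> (\<Union>n::nat. F n) \<in> gap_sequences \<I>"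
    if T: "\<forall>n. T n \<in> gap_sequences \<I>" for T g
  proof (cases "infinite {n. prod_decode ` T n \<in> \<I>}")
    case True
    define N where "N = {n. prod_decode ` T n \<in> \<I>}"
    have "\<forall>n. \<exists>f. n \<in> N \<longrightarrow> prod_decode ` T n \<subseteq> down_graph f"
      using tight_gap_down_graph[OF gap] unfolding N_def by blast
    then obtain f where f: "\<And>n. n \<in> N \<Longrightarrow> prod_decode ` T n \<subseteq> down_graph (f n)" by metis
    obtain h where h: "\<And>n m. n \<le> m \<Longrightarrow> f n m \<le> h m" using eventual_bound_of_sequence[of f] by blast
    have "infinite (T n \<inter> prod_decode -` b h)" if n: "n \<in> N" for n
    proof
      assume fin: "finite (T n \<inter> prod_decode -` b h)"
      have "finite (prod_decode ` T n \<inter> a h)"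
        using tight_gap_orthogonal[OF gap ab(1)] n by (subst Int_commute) (simp add: N_def)
      \<comment> \<open>The columns before \<open>n\<close>, where \<open>h\<close> need not bound
        \<open>f n\<close>, contain only finitely many points below \<open>f n\<close>.\<close>
      moreover have "prod_decode ` T n \<subseteq> prod_decode ` (T n \<inter> prod_decode -` b h) \<union>
          (prod_decode ` T n \<inter> a h) \<union> {(i, j). i \<in> {..<n} \<and> j < f n i}"
      proof
        fix z assume z: "z \<in> prod_decode ` T n"
        obtain i j where ij: "z = (i, j)" by fastforce
        have "j < f n i" using f[OF n] z ij by (auto simp: down_graph_def)
        moreover have "z \<in> a h \<union> b h" if "j < f n i" "n \<le> i"
          using h[OF that(2)] that(1) ij ab(3)[of h, symmetric] by (auto simp: down_graph_def)
        ultimately show "z \<in> prod_decode ` (T n \<inter> prod_decode -` b h) \<union>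
          (prod_decode ` T n \<inter> a h) \<union> {(i, j). i \<in> {..<n} \<and> j < f n i}"
          using z ij by (cases "n \<le> i") auto
      qed
      ultimately have "finite (prod_decode ` T n)"
        using fin finite_down_graph_columns[of "{..<n}" "f n"]
        by (elim finite_subset) simp
      then show False using T finite_imageD[OF _ inj] unfolding gap_sequences_def by blast
    qed
    \<comment> \<open>The condition \<open>n \<le> t n\<close> forces infinitely many values even if
      the \<open>T n\<close> overlap.\<close>
    then obtain t where t: "\<And>n. n \<in> N \<Longrightarrow> t n \<in> T n \<inter> prod_decode -` b h"
      "\<And>n. n \<in> N \<Longrightarrow> g n \<le> t n" "\<And>n. n \<in> N \<Longrightarrow> n \<le> t n"
      using infinite_nat_choice_above[of N "\<lambda>n. T n \<inter> prod_decode -` b h" g] by blast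
    have "infinite (t ` N)" using True t(3) infinite_if_unbounded_choice unfolding N_def by blast
    moreover have "prod_decode ` t ` N \<in> \<I>" by (rule sub[OF ab(2)[of h]]) (use t(1) in auto)
    moreover have "(\<Union>n. if n \<in> N then {t n} else {}) = t ` N" by (auto split: if_splits)
    ultimately show ?thesis
      using t by (intro exI[of _ "\<lambda>n. if n \<in> N then {t n} else {}"]) (auto simp: gap_sequences_def)
  next
    case False
    define N where "N = - {n. prod_decode ` T n \<in> \<I>}"
    have N: "infinite N" using False by (simp add: N_def finite_compl)
    have "\<forall>n. \<exists>k. n \<in> N \<longrightarrow> (\<forall>p\<in>T n. fst (prod_decode p) = k)"
      using T unfolding gap_sequences_def N_def by blast
    then obtain k where k: "\<And>n p. n \<in> N \<Longrightarrow> p \<in> T n \<Longrightarrow> fst (prod_decode p) = k n" by metis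
    have infT: "infinite (T n)" for n using T unfolding gap_sequences_def by blast
    show ?thesis
    proof (cases "finite (k ` N)")
      case True
      then obtain c where c: "infinite {n \<in> N. k n = c}"
        using pigeonhole_infinite[OF N True] by auto
      define M where "M = {n \<in> N. k n = c}"
      obtain t where t: "\<And>n. n \<in> M \<Longrightarrow> t n \<in> T n"
        "\<And>n. n \<in> M \<Longrightarrow> g n \<le> t n" "\<And>n. n \<in> M \<Longrightarrow> n \<le> t n"
        using infinite_nat_choice_above[of M T g] infT by blast
      have "infinite (t ` M)" using c t(3) infinite_if_unbounded_choice unfolding M_def by blast
      moreover have "\<forall>p\<in>t ` M. fst (prod_decode p) = c" using t(1) k unfolding M_def by fastforce
      moreover have "(\<Union>n. if n \<in> M then {t n} else {}) = t ` M" by (auto split: if_splits)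
      ultimately show ?thesis
        using t by (intro exI[of _ "\<lambda>n. if n \<in> M then {t n} else {}"]) (auto simp: gap_sequences_def)
    next
      case False
      define X where "X = (\<Union>n\<in>N. prod_decode ` (T n \<inter> {g n..}))"
      have "infinite (X \<inter> ({k n} \<times> UNIV))" if "n \<in> N" for n
      proof -
        have "T n \<subseteq> (T n \<inter> {g n..}) \<union> {..<g n}" by auto
        then have "infinite (T n \<inter> {g n..})" using infT by (meson finite_UnI finite_lessThan finite_subset)
        then have "infinite (prod_decode ` (T n \<inter> {g n..}))" using finite_imageD[OF _ inj] by blast
        moreover have "prod_decode ` (T n \<inter> {g n..}) \<subseteq> X \<inter> ({k n} \<times> UNIV)"
        proof
          fix z assume z: "z \<in> prod_decode ` (T n \<inter> {g n..})"
          then have "z \<in> X" using that by (auto simp: X_def)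
          moreover have "fst z = k n" using z k[OF that] by auto
          ultimately show "z \<in> X \<inter> ({k n} \<times> UNIV)" by (simp add: mem_Times_iff)
        qed
        ultimately show ?thesis using finite_subset by blast
      qed
      then have "k ` N \<subseteq> {n. infinite (X \<inter> ({n} \<times> UNIV))}" by blast
      then obtain f where f: "infinite (X \<inter> b f)" using tight False finite_subset by blast
      \<comment> \<open>Each piece lies in one column below \<open>f\<close>, so it is finite;
        together the pieces are exactly \<open>X \<inter> b f\<close>, which is infinite and in
        \<open>\<I>\<close>.\<close>
      define F where "F n = (if n \<in> N then T n \<inter> {g n..} \<inter> prod_decode -` b f else {})" for n
      have "finite (F n)" for n
      proof (cases "n \<in> N")
        case True
        have "prod_decode ` F n \<subseteq> {(i, j). i \<in> {k n} \<and> j < f i}"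
        proof
          fix z assume "z \<in> prod_decode ` F n"
          then have "fst z = k n" "z \<in> down_graph f"
            using True k[OF True] ab(3)[of f] by (auto simp: F_def)
          then show "z \<in> {(i, j). i \<in> {k n} \<and> j < f i}"
            by (simp add: down_graph_def case_prod_beta)
        qed
        then have "finite (prod_decode ` F n)"
          using finite_down_graph_columns[of "{k n}" f] finite_subset by blast
        then show ?thesis by (rule finite_imageD) (rule inj)
      qed (simp add: F_def)
      moreover have dec: "prod_decode ` (\<Union>n. F n) = X \<inter> b f"
        by (auto simp: F_def X_def split: if_splits)
      moreover have "infinite (\<Union>n. F n)" using dec f by (metis finite_imageI)
      moreover have "X \<inter> b f \<in> \<I>" using sub[OF ab(2)] by blast
      ultimately show ?thesis
        by (intro exI[of _ F]) (auto simp: gap_sequences_def F_def)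
    qed
  qed
  have "S \<in> gap_sequences \<I>" if "T \<in> gap_sequences \<I>" "S \<subseteq> T" "infinite S" for S T
    using that sub[of "prod_decode ` T" "prod_decode ` S"] unfolding gap_sequences_def by blast
  then show ?thesis unfolding selective_def using sel by (auto simp: gap_sequences_def)
qed

text \<open>Sequences in the ideal are covered by orthogonality. For the others, \<open>A\<close>
  lies below a graph and so meets each column in a finite set.\<close>

lemma gap_sequences_orthogonal:
  assumes gap: "tight_gap \<I>' \<I>" and "T \<in> gap_sequences \<I>" and A: "A \<in> \<I>'"
  shows "finite (T \<inter> prod_decode -` A)"
proof -
  obtain f where f: "A \<subseteq> down_graph f" using tight_gap_down_graph[OF gap] A by blast
  have "finite (prod_decode ` T \<inter> A)"
  proof (cases "prod_decode ` T \<in> \<I>")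
    case True
    then show ?thesis
      using tight_gap_orthogonal[OF gap A True] by (simp add: Int_commute)
  next
    case False
    then obtain k where "\<forall>p\<in>T. fst (prod_decode p) = k"
      using assms(2) unfolding gap_sequences_def by blast
    then have "prod_decode ` T \<inter> A \<subseteq> {(i, j). i \<in> {k} \<and> j < f i}"
      using f by (auto simp: down_graph_def) (metis fst_conv)
    then show ?thesis using finite_down_graph_columns[of "{k}" f] finite_subset by blast
  qed
  moreover have "prod_decode ` (T \<inter> prod_decode -` A) \<subseteq> prod_decode ` T \<inter> A" by blast
  ultimately have "finite (prod_decode ` (T \<inter> prod_decode -` A))" by (rule rev_finite_subset)
  then show ?thesis by (rule finite_imageD) (rule inj_prod_decode)
qed

section \<open>Forests and the initial convergent sequences\<close>

text \<open>The sets of descendants in the forest given by a parent function form a countable separating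
  family for which the children of a node converge to it.\<close>

definition descendants :: "('a \<Rightarrow> 'a) \<Rightarrow> 'a \<Rightarrow> 'a set" where
  "descendants par c = {p. \<exists>k. (par ^^ k) p = c}"

text \<open>Every point descends from itself, and descendants of \<open>c\<close> are at least
  \<open>c\<close>; so distinct points cannot descend from each other.\<close>

lemma descendants_separate:
  fixes par :: "nat \<Rightarrow> nat"
  assumes "\<And>p. par p \<le> p" and "x \<noteq> y"
  shows "\<exists>c. (x \<in> descendants par c) \<noteq> (y \<in> descendants par c)"
proof -
  have le: "(par ^^ k) p \<le> p" for k p
    by (induction k) (use assms(1) order_trans in auto)
  have self: "p \<in> descendants par p" for p
    unfolding descendants_def by (auto intro: exI[of _ 0])
  have "c \<le> p" if "p \<in> descendants par c" for c p
    using that le unfolding descendants_def by blast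
  then show ?thesis using assms(2) self by (metis order_antisym)
qed

text \<open>A child of \<open>x\<close> other than \<open>c\<close> descends from \<open>c\<close>
  exactly when \<open>x\<close> does, so \<open>c\<close> is the only possible exception.\<close>

lemma children_settle_descendants:
  assumes "\<And>p. p \<in> S \<Longrightarrow> par p = x"
  shows "settles S x (descendants par c)"
proof -
  have "p \<in> descendants par c \<longleftrightarrow> x \<in> descendants par c" if "p \<in> S" "p \<noteq> c" for p
  proof
    assume "p \<in> descendants par c"
    then obtain k where k: "(par ^^ k) p = c" unfolding descendants_def by blast
    with that(2) obtain j where "k = Suc j" by (cases k) auto
    with k have "(par ^^ j) x = c" using assms[OF that(1)] by (simp add: funpow_Suc_right del: funpow.simps)
    then show "x \<in> descendants par c" unfolding descendants_def by blast
  next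
    assume "x \<in> descendants par c"
    then obtain j where "(par ^^ j) x = c" unfolding descendants_def by blast
    then have "(par ^^ Suc j) p = c" using assms[OF that(1)] by (simp add: funpow_Suc_right del: funpow.simps)
    then show "p \<in> descendants par c" unfolding descendants_def by blast
  qed
  then have "{t \<in> S. (t \<in> descendants par c) \<noteq> (x \<in> descendants par c)} \<subseteq> {c}" by blast
  then show ?thesis unfolding settles_def using finite_subset by blast
qed

lemma gap_space:
  assumes bc: "bounding_number =o continuum" and gap: "tight_gap \<I>' \<I>"
    and par: "\<And>p. par p \<le> p"
  obtains X :: "nat topology" where "topspace X = UNIV" "regular_space X" "Hausdorff_space X"
    "frechet_urysohn_space X"
    and "\<forall>x n W. openin X W \<and> x \<in> W \<longrightarrow> finite ({p. fst (prod_decode p) = n \<and> par p = x} - W)"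
    and "\<forall>A\<in>\<I>'. \<forall>x. \<exists>W. openin X W \<and> x \<in> W \<and> W \<inter> prod_decode -` A \<subseteq> {x}"
proof -
  define Z where "Z n x = {p. fst (prod_decode p) = n \<and> par p = x}" for n x
  \<comment> \<open>Candidates must be infinite; for finite \<open>Z n x\<close> the convergence
    claim is trivial.\<close>
  define C where "C = (\<lambda>(n, x). (Z n x, x)) ` {(n, x). infinite (Z n x)}"
  have C: "countable C" "\<And>S x. (S, x) \<in> C \<Longrightarrow> S \<in> gap_sequences \<I>"
    unfolding C_def by (auto simp: gap_sequences_def) (auto simp: Z_def)
  have conv: "settles S x (descendants par i)" if "(S, x) \<in> C" for S x i
    by (rule children_settle_descendants) (use that in \<open>auto simp: C_def Z_def\<close>)
  obtain X where X: "topspace X = UNIV" "regular_space X" "Hausdorff_space X" "frechet_urysohn_space X"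
    "\<forall>(S, x)\<in>C. \<forall>W. openin X W \<and> x \<in> W \<longrightarrow> finite (S - W)"
    "\<forall>A x. (\<forall>T\<in>gap_sequences \<I>. finite (T \<inter> A)) \<longrightarrow> (\<exists>W. openin X W \<and> x \<in> W \<and> W \<inter> A \<subseteq> {x})"
    by (rule selective_space[OF bc selective_gap_sequences[OF gap] C descendants_separate[OF par] conv])
  show thesis
  proof (rule that[OF X(1-4)])
    have "finite (Z n x - W)" if "openin X W" "x \<in> W" for n x W
    proof (cases "infinite (Z n x)")
      case True
      then have "(Z n x, x) \<in> C" by (auto simp: C_def)
      then show ?thesis using X(5) that by blast
    qed simp
    then show "\<forall>x n W. openin X W \<and> x \<in> W \<longrightarrow> finite ({p. fst (prod_decode p) = n \<and> par p = x} - W)"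
      by (simp add: Z_def)
    show "\<forall>A\<in>\<I>'. \<forall>x. \<exists>W. openin X W \<and> x \<in> W \<and> W \<inter> prod_decode -` A \<subseteq> {x}"
      using X(6) gap_sequences_orthogonal[OF gap] by meson
  qed
qed

section \<open>The product of the two spaces\<close>

text \<open>A point codes \<open>(n, (x, (y, j)))\<close>: its column, its two parents and a free
  index.\<close>

lemma two_parent_functions:
  obtains par\<^sub>1 par\<^sub>2 :: "nat \<Rightarrow> nat" where "\<forall>p. par\<^sub>1 p \<le> p" "\<forall>p. par\<^sub>2 p \<le> p"
    and "\<forall>n x y. infinite {p. fst (prod_decode p) = n \<and> par\<^sub>1 p = x \<and> par\<^sub>2 p = y}"
proof
  let ?par\<^sub>1 = "\<lambda>p. fst (prod_decode (snd (prod_decode p)))"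
  let ?par\<^sub>2 = "\<lambda>p. fst (prod_decode (snd (prod_decode (snd (prod_decode p)))))"
  have le: "fst (prod_decode p) \<le> p" "snd (prod_decode p) \<le> p" for p
    using le_prod_encode_1[of "fst (prod_decode p)" "snd (prod_decode p)"]
      le_prod_encode_2[of "snd (prod_decode p)" "fst (prod_decode p)"] by simp_all
  show "\<forall>p. ?par\<^sub>1 p \<le> p" "\<forall>p. ?par\<^sub>2 p \<le> p"
    using le order_trans by meson+
  have "infinite {p. fst (prod_decode p) = n \<and> ?par\<^sub>1 p = x \<and> ?par\<^sub>2 p = y}" for n x y
  proof -
  let ?s = "\<lambda>j. prod_encode (n, prod_encode (x, prod_encode (y, j)))"
  have "infinite (range ?s)" by (rule range_inj_infinite) (auto simp: inj_on_def prod_encode_eq)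
  moreover have "range ?s \<subseteq> {p. fst (prod_decode p) = n \<and> ?par\<^sub>1 p = x \<and> ?par\<^sub>2 p = y}" by auto
  ultimately show ?thesis using finite_subset by blast
  qed
  then show "\<forall>n x y. infinite {p. fst (prod_decode p) = n \<and> ?par\<^sub>1 p = x \<and> ?par\<^sub>2 p = y}" by blast
qed

theorem theorem3p3:
  assumes "bounding_number =o continuum"
    and "\<exists>\<I>\<^sub>1 \<I>\<^sub>2. tight_gap \<I>\<^sub>1 \<I>\<^sub>2"
  shows "\<exists>(X :: nat topology) (Y :: nat topology).
     countable (topspace X) \<and> regular_space X \<and> Hausdorff_space X \<and> frechet_urysohn_space X \<and>
     countable (topspace Y) \<and> regular_space Y \<and> Hausdorff_space Y \<and> frechet_urysohn_space Y \<and>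
     \<not> M_separable_space (prod_topology X Y)"
proof -
  obtain \<I>\<^sub>1 \<I>\<^sub>2 where gap: "tight_gap \<I>\<^sub>1 \<I>\<^sub>2" using assms(2) by blast
  obtain par\<^sub>1 par\<^sub>2 :: "nat \<Rightarrow> nat" where par: "\<forall>p. par\<^sub>1 p \<le> p" "\<forall>p. par\<^sub>2 p \<le> p"
    and inf: "\<forall>n x y. infinite {p. fst (prod_decode p) = n \<and> par\<^sub>1 p = x \<and> par\<^sub>2 p = y}"
    by (rule two_parent_functions)
  obtain X where X: "topspace X = UNIV" "regular_space X" "Hausdorff_space X" "frechet_urysohn_space X"
    and Xconv: "\<forall>x n W. openin X W \<and> x \<in> W \<longrightarrow> finite ({p. fst (prod_decode p) = n \<and> par\<^sub>1 p = x} - W)"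
    and Xdisc: "\<forall>A\<in>\<I>\<^sub>1. \<forall>x. \<exists>W. openin X W \<and> x \<in> W \<and> W \<inter> prod_decode -` A \<subseteq> {x}"
    by (rule gap_space[OF assms(1) gap par(1)[rule_format]])
  \<comment> \<open>The same construction with the ideals exchanged.\<close>
  obtain Y where Y: "topspace Y = UNIV" "regular_space Y" "Hausdorff_space Y" "frechet_urysohn_space Y"
    and Yconv: "\<forall>x n W. openin Y W \<and> x \<in> W \<longrightarrow> finite ({p. fst (prod_decode p) = n \<and> par\<^sub>2 p = x} - W)"
    and Ydisc: "\<forall>A\<in>\<I>\<^sub>2. \<forall>x. \<exists>W. openin Y W \<and> x \<in> W \<and> W \<inter> prod_decode -` A \<subseteq> {x}"
    by (rule gap_space[OF assms(1) tight_gap_commute[OF gap] par(2)[rule_format]])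
  define D where "D n = (\<lambda>p. (p, p)) ` {p. fst (prod_decode p) = n}" for n
  have "dense_subset_of (prod_topology X Y) (D n)" for n
  proof -
    have "(x, y) \<in> prod_topology X Y closure_of D n" for x y
      unfolding in_closure_of
    proof (intro conjI allI impI)
      fix T assume "(x, y) \<in> T \<and> openin (prod_topology X Y) T"
      then obtain U W where UW: "openin X U" "openin Y W" "x \<in> U" "y \<in> W" "U \<times> W \<subseteq> T"
        unfolding openin_prod_topology_alt by blast
      \<comment> \<open>This infinite set is almost contained in both \<open>U\<close> and
        \<open>W\<close>, so some \<open>p\<close> in column \<open>n\<close> has
        \<open>(p, p)\<close> in the box.\<close>
      let ?Z = "{p. fst (prod_decode p) = n \<and> par\<^sub>1 p = x \<and> par\<^sub>2 p = y}"
      have "?Z \<subseteq> ({p. fst (prod_decode p) = n \<and> par\<^sub>1 p = x} - U) \<union>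
          ({p. fst (prod_decode p) = n \<and> par\<^sub>2 p = y} - W)" if "?Z \<inter> U \<inter> W = {}"
        using that by blast
      then have "?Z \<inter> U \<inter> W \<noteq> {}"
        using inf Xconv Yconv UW(1-4) by (meson finite_UnI finite_subset)
      then show "\<exists>z. z \<in> D n \<and> z \<in> T" using UW(5) unfolding D_def by blast
    qed (simp add: X Y)
    then show ?thesis unfolding dense_subset_of_def by (auto simp: X Y)
  qed
  moreover have "\<not> dense_subset_of (prod_topology X Y) (\<Union>n. H n)"
    if H: "\<forall>n. finite (H n) \<and> H n \<subseteq> D n" for H
  proof
    assume dense: "dense_subset_of (prod_topology X Y) (\<Union>n. H n)"
    have "\<forall>n. \<exists>m. (snd \<circ> prod_decode \<circ> fst) ` H n \<subseteq> {..<m}"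
      using H by (meson finite_imageI finite_nat_iff_bounded)
    \<comment> \<open>Finiteness of each \<open>H n\<close> puts the whole selection over a single
      \<open>down_graph f\<close>.\<close>
    then obtain f where f: "\<And>n. (snd \<circ> prod_decode \<circ> fst) ` H n \<subseteq> {..<f n}" by metis
    obtain a b where ab: "a \<in> \<I>\<^sub>1" "b \<in> \<I>\<^sub>2" "down_graph f = a \<union> b"
      using tight_gap_splitting[OF gap] by metis
    have diag: "prod_decode p \<in> a \<union> b \<and> q = p" if "(p, q) \<in> H n" for p q n
    proof -
      have "q = p" "fst (prod_decode p) = n" using H that unfolding D_def by blast+
      moreover have "snd (prod_decode p) < f n" using f[of n] that by force
      ultimately show ?thesis using ab(3) by (auto simp: down_graph_def case_prod_beta)
    qed
    \<comment> \<open>The point \<open>(0, 1)\<close> is off the diagonal. A selected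
      \<open>(p, p)\<close> in \<open>U \<times> W\<close> has \<open>p = 0\<close> if it lies over
      \<open>a\<close> and \<open>p = 1\<close> if over \<open>b\<close>; deleting \<open>1\<close>
      from \<open>U\<close> and \<open>0\<close> from \<open>W\<close> excludes both.\<close>
    obtain U where U: "openin X U" "0 \<in> U" "U \<inter> prod_decode -` a \<subseteq> {0}" using Xdisc[rule_format, OF ab(1), of 0] by blast
    obtain W where W: "openin Y W" "1 \<in> W" "W \<inter> prod_decode -` b \<subseteq> {1}" using Ydisc[rule_format, OF ab(2), of 1] by blast
    have "closedin X {1}" "closedin Y {0}"
      using X Y by (simp_all add: closedin_Hausdorff_sing_eq)
    then have "openin (prod_topology X Y) ((U - {1}) \<times> (W - {0}))"
      using U(1) W(1) by (simp add: openin_prod_Times_iff openin_diff)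
    moreover have "(0, 1) \<in> (U - {1}) \<times> (W - {0})" using U(2) W(2) by simp
    moreover have "(0, 1) \<in> prod_topology X Y closure_of (\<Union>n. H n)"
      using dense X Y unfolding dense_subset_of_def by simp
    ultimately obtain z where z: "z \<in> (\<Union>n. H n)" "z \<in> (U - {1}) \<times> (W - {0})"
      by (meson in_closure_of)
    obtain p q n where pq: "z = (p, q)" "(p, q) \<in> H n" using z(1) by (cases z) auto
    then have "prod_decode p \<in> a \<union> b" "q = p" using diag by blast+
    then show False using U(3) W(3) z(2) pq(1) by auto
  qed
  ultimately have "\<not> M_separable_space (prod_topology X Y)"
    unfolding M_separable_space_def by metis
  then show ?thesis using X Y by (intro exI[of _ X] exI[of _ Y]) simp
qed

end
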